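(* Let $K\subset\mathbb{R}^n$ be a convex body with non-empty interior which is a $1$-tangential body of a convex body $E\subset\mathbb{R}^n$ with non-empty interior. Let $a_1\le\dots\le a_n$ be the real parts of the $n$ complex roots (counted with multiplicity) of the relative Steiner polynomial $f(K,E,s)=\sum_{i=0}^n\binom{n}{i}\mathrm{W}_i(K;E)\,s^i$. Then $$a_1\le -\mathrm{R}(K;E)\le -\mathrm{r}(K;E)\le a_n\le 0 .$$
   Context: A convex body is a compact convex set in $\mathbb{R}^n$. For convex bodies $K,E\subset\mathbb{R}^n$, the relative quermassintegrals $\mathrm{W}_i(K;E)$, $0\le i\le n$, are the coefficients defined by $\mathrm{V}(K+\rho E)=\sum_{i=0}^n\binom{n}{i}\mathrm{W}_i(K;E)\rho^i$ for all $\rho\ge0$, where $\mathrm{V}$ is $n$-dimensional Lebesgue measure. The relative Steiner polynomial $f(K,E,s)=\sum_{i=0}^n\binom{n}{i}\mathrm{W}_i(K;E)s^i$ is regarded as a polynomial in the complex variable $s$. Relative inradius: $\mathrm{r}(K;E)=\max\{r:\exists\,x\in\mathbb{R}^n \text{ with } x+rE\subseteq K\}$. Relative circumradius: $\mathrm{R}(K;E)=\min\{R:\exists\,x\in\mathbb{R}^n\text{ with }K\subseteq x+RE\}$. Tangential bodies: a boundary point $x$ of $K$ is an $r$-singular point of $K$ if the normal cone of $K$ at $x$ has dimension at least $n-r$. For $p\in\{0,\dots,n-1\}$, a convex body $K$ containing the convex body $E$ is called a $p$-tangential body of $E$ if each support hyperplane of $K$ that is not a support hyperplane of $E$ contains only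 $(p-1)$-singular points of $K$ (i.e. every point of $K$ in that hyperplane is a $(p-1)$-singular point of $K$). *)

theory Defs
  imports "HOL-Analysis.Analysis" "HOL-Computational_Algebra.Computational_Algebra"
begin

definition convex_body :: "'a::euclidean_space set \<Rightarrow> bool" where
  "convex_body K \<longleftrightarrow> compact K \<and> convex K"

text \<open>The homothetic copy \<open>x + r E\<close>.\<close>

definition homothet :: "'a::euclidean_space \<Rightarrow> real \<Rightarrow> 'a set \<Rightarrow> 'a set" where
  "homothet x r E = (\<lambda>y. x + r *\<^sub>R y) ` E"

text \<open>In \<open>K + homothet 0 \<rho> E\<close>, the sign \<open>+\<close> is the Minkowski sum of sets.\<close>

definition steiner_coeffs ::
    "'a::euclidean_space set \<Rightarrow> 'a set \<Rightarrow> (nat \<Rightarrow> real) \<Rightarrow> bool" where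
  "steiner_coeffs K E W \<longleftrightarrow>
     (\<forall>\<rho>\<ge>0. measure lebesgue (K + homothet 0 \<rho> E) =
        (\<Sum>i\<le>DIM('a). real (DIM('a) choose i) * W i * \<rho> ^ i))"

text \<open>Only \<open>W\<^sub>0, \<dots>, W\<^sub>n\<close> are determined by the Steiner formula;
  the values at indices beyond the dimension are fixed to 0 so that the description is unique.\<close>

definition quermassintegral :: "'a::euclidean_space set \<Rightarrow> 'a set \<Rightarrow> nat \<Rightarrow> real" where
  "quermassintegral K E =
     (THE W. steiner_coeffs K E W \<and> (\<forall>i>DIM('a). W i = 0))"

lemma quermassintegral_eq:
  fixes K E :: "'a::euclidean_space set"
  assumes "steiner_coeffs K E W" "i \<le> DIM('a)"
  shows "quermassintegral K E i = W i"
proof -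
  let ?n = "DIM('a)"
  define W' where "W' i = (if i \<le> ?n then W i else 0)" for i
  have W': "steiner_coeffs K E W'"
    using assms(1) by (simp add: steiner_coeffs_def W'_def)
  have "quermassintegral K E = W'"
    unfolding quermassintegral_def
  proof (rule the_equality)
    show "steiner_coeffs K E W' \<and> (\<forall>i>?n. W' i = 0)"
      using W' by (simp add: W'_def)
  next
    fix U assume U: "steiner_coeffs K E U \<and> (\<forall>i>?n. U i = 0)"
    define p where "p V = (\<Sum>i\<le>?n. monom (real (?n choose i) * V i) i)" for V :: "nat \<Rightarrow> real"
    have poly_p: "poly (p V) x = (\<Sum>i\<le>?n. real (?n choose i) * V i * x ^ i)" for V x
      by (simp add: p_def poly_sum poly_monom)
    have coeff_p: "coeff (p V) j = real (?n choose j) * V j" if "j \<le> ?n" for V j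
      using that by (simp add: p_def coeff_sum if_distrib cong: if_cong)
    have "{0..} \<subseteq> {x. poly (p U - p W') x = 0}"
      using U W' by (auto simp: poly_p steiner_coeffs_def)
    then have "infinite {x. poly (p U - p W') x = 0}"
      using infinite_Ici finite_subset by blast
    then have "p U - p W' = 0"
      using poly_roots_finite by blast
    then have "p U = p W'" by simp
    show "U = W'"
    proof
      fix j show "U j = W' j"
      proof (cases "j \<le> ?n")
        case True
        then have "real (?n choose j) * U j = real (?n choose j) * W' j"
          using coeff_p[of j] \<open>p U = p W'\<close> by metis
        then show ?thesis using True by (simp add: binomial_eq_0_iff)
      next
        case False
        then show ?thesis using U by (simp add: W'_def)
      qed
    qed
  qed
  then show ?thesis using assms(2) by (simp add: W'_def)
qed

definition steiner_poly :: "'a::euclidean_space set \<Rightarrow> 'a set \<Rightarrow> complex poly" where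
  "steiner_poly K E =
     (\<Sum>i\<le>DIM('a). monom (complex_of_real (real (DIM('a) choose i) * quermassintegral K E i)) i)"

text \<open>The maximum and the minimum are over nonnegative factors: without this restriction,
  arbitrarily negative factors would be admissible in the circumradius of a body \<open>E\<close>
  with nonempty interior.\<close>

definition relative_inradius :: "'a::euclidean_space set \<Rightarrow> 'a set \<Rightarrow> real" where
  "relative_inradius K E = (GREATEST r. 0 \<le> r \<and> (\<exists>x. homothet x r E \<subseteq> K))"

definition relative_circumradius :: "'a::euclidean_space set \<Rightarrow> 'a set \<Rightarrow> real" where
  "relative_circumradius K E = (LEAST R. 0 \<le> R \<and> (\<exists>x. K \<subseteq> homothet x R E))"

definition support_hyperplane :: "'a::euclidean_space set \<Rightarrow> 'a set \<Rightarrow> bool" where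
  "support_hyperplane K H \<longleftrightarrow>
     (\<exists>u c. u \<noteq> 0 \<and> H = {y. u \<bullet> y = c} \<and> K \<subseteq> {y. u \<bullet> y \<le> c} \<and> K \<inter> H \<noteq> {})"

definition normal_cone :: "'a::euclidean_space set \<Rightarrow> 'a \<Rightarrow> 'a set" where
  "normal_cone K x = {u. \<forall>y\<in>K. u \<bullet> (y - x) \<le> 0}"

text \<open>The index \<open>r\<close> is an integer because \<open>p\<close>-tangential bodies refer to
  \<open>(p - 1)\<close>-singular points for \<open>p = 0\<close> as well; no point is \<open>-1\<close>-singular.\<close>

definition singular_point :: "int \<Rightarrow> 'a::euclidean_space set \<Rightarrow> 'a \<Rightarrow> bool" where
  "singular_point r K x \<longleftrightarrow>
     x \<in> frontier K \<and> int DIM('a) - r \<le> int (dim (normal_cone K x))"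

definition tangential_body :: "nat \<Rightarrow> 'a::euclidean_space set \<Rightarrow> 'a set \<Rightarrow> bool" where
  "tangential_body p K E \<longleftrightarrow>
     p < DIM('a) \<and> convex_body K \<and> convex_body E \<and> E \<subseteq> K \<and>
     (\<forall>H. support_hyperplane K H \<and> \<not> support_hyperplane E H \<longrightarrow>
        (\<forall>x\<in>K \<inter> H. singular_point (int p - 1) K x))"

end

theory Submission
  imports Defs
begin

text \<open>The set \<open>K - E\<close> splits into countably many disjoint caps, each starshaped about an apex of
  \<open>K\<close> with full-dimensional normal cone, and \<open>(1 + \<rho>) K\<close> is the disjoint union of \<open>K + \<rho> E\<close>
  and the caps rescaled by \<open>\<rho>\<close>. Hence
  \<open>V(K + \<rho> E) = V(K) (1 + \<rho>)\<^sup>n - (V(K) - V(E)) \<rho>\<^sup>n\<close>, so the roots of the Steiner polynomial are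
  \<open>- 1 / (1 - \<beta> \<omega>)\<close> with \<open>\<beta>\<^sup>n = 1 - V(E) / V(K)\<close> and \<open>\<omega>\<^sup>n = 1\<close>. The inradius is 1, and a root
  with \<open>Re \<omega> \<le> 0\<close> has real part at least \<open>- 1\<close>. The root with \<open>\<omega> = 1\<close> bounds the circumradius:
  for \<open>b > \<beta>\<close> the caps rescaled by \<open>1 / b\<close> about their apexes cannot cover \<open>K\<close>, and an uncovered
  point is the centre of a homothetic copy of \<open>E\<close> with factor \<open>1 / (1 - b)\<close> containing \<open>K\<close>.\<close>

section \<open>Countable subadditivity and volumes of homothets\<close>

text \<open>Subadditivity in integral form, for the rescaled caps of the circumradius argument,
  which may overlap. An enumeration of \<open>I\<close> turns the family into a disjoint one with
  the same union.\<close>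

lemma emeasure_UN_countable_le:
  assumes sets: "\<And>i. i \<in> I \<Longrightarrow> X i \<in> sets M" and "countable I"
  shows "emeasure M (\<Union>(X ` I)) \<le> (\<integral>\<^sup>+i. emeasure M (X i) \<partial>count_space I)"
proof -
  define e where "e = to_nat_on I"
  have inj: "inj_on e I"
    using \<open>countable I\<close> by (simp add: e_def inj_on_to_nat_on)
  define Y where "Y i = X i - (\<Union>j\<in>{j\<in>I. e j < e i}. X j)" for i
  have Y_sets: "Y i \<in> sets M" if "i \<in> I" for i
    unfolding Y_def
    by (intro sets.Diff sets sets.countable_UN'' countable_subset[OF _ \<open>countable I\<close>])
       (use that in auto)
  have disj: "disjoint_family_on Y I"
    unfolding disjoint_family_on_def Y_def
  proof safe
    fix i j x
    assume "i \<in> I" "j \<in> I" "i \<noteq> j" "x \<in> X i" "x \<in> X j"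
      "x \<notin> \<Union> (X ` {k \<in> I. e k < e i})" "x \<notin> \<Union> (X ` {k \<in> I. e k < e j})"
    moreover have "e i < e j \<or> e j < e i"
      using inj_onD[OF inj] \<open>i \<in> I\<close> \<open>j \<in> I\<close> \<open>i \<noteq> j\<close> by (meson linorder_neqE_nat)
    ultimately show "x \<in> {}" by blast
  qed
  have "\<exists>i\<in>I. x \<in> Y i" if "i \<in> I" "x \<in> X i" for i x
    using that
  proof (induction "e i" arbitrary: i rule: less_induct)
    case less
    then show ?case by (cases "x \<in> Y i") (auto simp: Y_def)
  qed
  then have "\<Union>(X ` I) = \<Union>(Y ` I)"
    by (fastforce simp: Y_def)
  then have "emeasure M (\<Union>(X ` I)) = (\<integral>\<^sup>+i. emeasure M (Y i) \<partial>count_space I)"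
    using emeasure_UN_countable[OF Y_sets \<open>countable I\<close> disj] by simp
  also have "\<dots> \<le> (\<integral>\<^sup>+i. emeasure M (X i) \<partial>count_space I)"
    by (intro nn_integral_mono emeasure_mono) (auto simp: Y_def intro: sets)
  finally show ?thesis .
qed

lemma homothet_lmeasurable:
  fixes S :: "'a::euclidean_space set"
  assumes S: "S \<in> lmeasurable"
  shows "homothet x r S \<in> lmeasurable"
proof (cases "r = 0")
  case True
  then have "homothet x r S \<subseteq> {x}"
    by (auto simp: homothet_def)
  then show ?thesis
    by (metis finite.emptyI finite.insertI finite_imp_compact finite_subset lmeasurable_compact)
next
  case False
  have "(*\<^sub>R) r ` S = (*\<^sub>R) (1 / r) -` S \<inter> space lebesgue"
    using False by (auto intro!: image_eqI[of _ "(*\<^sub>R) r" "(1 / r) *\<^sub>R _"])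
  also have "\<dots> \<in> sets lebesgue"
    using S by (intro measurable_sets[OF lebesgue_measurable_scaling]) auto
  finally have "(*\<^sub>R) r ` S \<in> lmeasurable"
    using S emeasure_lebesgue_affine[of r 0 S]
    by (auto simp: fmeasurable_def ennreal_mult_less_top ennreal_power)
  then show ?thesis
    using measurable_translation[of "(*\<^sub>R) r ` S" x] by (simp add: homothet_def image_image)
qed

lemma emeasure_homothet:
  fixes S :: "'a::euclidean_space set"
  assumes "0 \<le> r"
  shows "emeasure lebesgue (homothet x r S) = ennreal (r ^ DIM('a)) * emeasure lebesgue S"
  using emeasure_lebesgue_affine[of r x S] assms
  by (simp add: homothet_def add.commute ennreal_power)

lemma measure_homothet:
  fixes S :: "'a::euclidean_space set"
  assumes "0 \<le> r"
  shows "measure lebesgue (homothet x r S) = r ^ DIM('a) * measure lebesgue S"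
  using measure_lebesgue_affine[of r x S] assms
  by (simp add: homothet_def add.commute)

section \<open>Normal cones and points of contact\<close>

lemma zero_in_normal_cone: "0 \<in> normal_cone K x"
  by (simp add: normal_cone_def)

lemma convex_normal_cone: "convex (normal_cone K x)"
proof -
  have "normal_cone K x = (\<Inter>y\<in>K. {u. (y - x) \<bullet> u \<le> 0})"
    by (auto simp: normal_cone_def inner_commute)
  then show ?thesis
    by (simp add: convex_INT convex_halfspace_le)
qed

lemma full_normal_cone_not_orthogonal:
  fixes K :: "'a::euclidean_space set"
  assumes "dim (normal_cone K x) = DIM('a)" and "v \<noteq> 0"
  obtains u where "u \<in> normal_cone K x" "u \<bullet> v \<noteq> 0"
proof (rule ccontr)
  assume "\<not> thesis"
  then have "normal_cone K x \<subseteq> {u. v \<bullet> u = 0}"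
    using that by (auto simp: inner_commute)
  then have "dim (normal_cone K x) \<le> DIM('a) - 1"
    using dim_subset dim_hyperplane[OF \<open>v \<noteq> 0\<close>] by metis
  then show False
    using assms(1) DIM_positive[where 'a='a] by linarith
qed

text \<open>A convex set with empty interior lies in a hyperplane; as the cone contains
  \<open>0\<close>, this hyperplane is a linear subspace, too small for a cone of full
  dimension.\<close>

lemma interior_full_normal_cone:
  fixes K :: "'a::euclidean_space set"
  assumes "dim (normal_cone K x) = DIM('a)"
  shows "interior (normal_cone K x) \<noteq> {}"
proof
  assume "interior (normal_cone K x) = {}"
  then obtain a b where "a \<noteq> 0" and sub: "normal_cone K x \<subseteq> {u. a \<bullet> u = b}"
    using empty_interior_subset_hyperplane[OF convex_normal_cone] by metis
  moreover have "b = 0"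
    using sub zero_in_normal_cone[of K x] by auto
  ultimately show False
    using full_normal_cone_not_orthogonal[OF assms \<open>a \<noteq> 0\<close>] by (auto simp: inner_commute)
qed

text \<open>A common normal \<open>u\<close> ranks \<open>q\<close> no lower than \<open>p\<close>;
  tilted slightly towards \<open>q - p\<close> it ranks \<open>q\<close> strictly higher, yet it
  would still be a normal at \<open>p\<close>.\<close>

lemma interior_normal_cones_disjoint:
  assumes "p \<in> K" "q \<in> K" "p \<noteq> q"
  shows "interior (normal_cone K p) \<inter> interior (normal_cone K q) = {}"
proof (rule ccontr)
  assume "\<not> ?thesis"
  then obtain u where u: "u \<in> interior (normal_cone K p)" "u \<in> normal_cone K q"
    using interior_subset by blast
  then have "0 \<le> u \<bullet> (q - p)"
    using assms by (auto simp: normal_cone_def inner_diff_right)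
  obtain d where d: "d > 0" "cball u d \<subseteq> normal_cone K p"
    using u(1) mem_interior_cball by metis
  define v where "v = (d / norm (q - p)) *\<^sub>R (q - p)"
  have "u + v \<in> cball u d"
    using \<open>d > 0\<close> by (simp add: v_def dist_norm)
  then have "(u + v) \<bullet> (q - p) \<le> 0"
    using d(2) assms by (auto simp: normal_cone_def)
  moreover have "v \<bullet> (q - p) > 0"
    using assms \<open>d > 0\<close> by (simp add: v_def)
  ultimately show False
    using \<open>0 \<le> u \<bullet> (q - p)\<close> by (simp add: inner_add_left)
qed

text \<open>The interiors of these cones are nonempty, open and pairwise disjoint, and a Euclidean
  space has room for only countably many such sets.\<close>

lemma countable_full_normal_cones:
  fixes K :: "'a::euclidean_space set"
  shows "countable {p \<in> K. dim (normal_cone K p) = DIM('a)}" (is "countable ?P")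
proof (rule countable_image_inj_on)
  let ?N = "\<lambda>p. interior (normal_cone K p)"
  show "countable (?N ` ?P)"
  proof (rule countable_disjoint_nonempty_interior_subsets)
    show "pairwise disjnt (?N ` ?P)"
      using interior_normal_cones_disjoint[of _ K]
      by (auto simp: pairwise_def disjnt_def)
  qed auto
  show "inj_on ?N ?P"
  proof (rule inj_onI, rule ccontr)
    fix p q assume "p \<in> ?P" "q \<in> ?P" "?N p = ?N q" "p \<noteq> q"
    then show False
      using interior_normal_cones_disjoint[of p K q] interior_full_normal_cone[of K q] by auto
  qed
qed

lemma normal_cone_nonempty:
  assumes "compact K" "K \<noteq> {}"
  obtains x where "x \<in> K" "u \<in> normal_cone K x"
proof -
  have "continuous_on K (\<lambda>y. u \<bullet> y)"
    by (intro continuous_intros)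
  then obtain x where "x \<in> K" "\<forall>y\<in>K. u \<bullet> y \<le> u \<bullet> x"
    using continuous_attains_sup assms by metis
  then show thesis
    using that by (simp add: normal_cone_def inner_diff_right)
qed

lemma separating_direction:
  fixes S :: "'a::euclidean_space set"
  assumes "convex S" "compact S" "w \<notin> S"
  obtains u where "\<forall>e\<in>S. u \<bullet> e < u \<bullet> w"
proof -
  obtain a b where "a \<bullet> w < b" "\<forall>x\<in>S. a \<bullet> x > b"
    using separating_hyperplane_closed_point[OF assms(1) compact_imp_closed[OF assms(2)] assms(3)]
    by blast
  then have "\<forall>e\<in>S. (- a) \<bullet> e < (- a) \<bullet> w" by fastforce
  then show thesis by (rule that)
qed

section \<open>Caps of a \<open>1\<close>-tangential body\<close>

text \<open>Apart from the bound on the dimension, \<open>full_cone\<close> is what is taken from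
  \<open>1\<close>-tangency. It is phrased with outer normals instead of hyperplanes so that
  convexity can be used in the space of directions.\<close>

locale cap_body =
  fixes K E :: "'a::euclidean_space set"
  assumes compact_K: "compact K" and convex_K: "convex K"
    and compact_E: "compact E" and convex_E: "convex E"
    and E_subset_K: "E \<subseteq> K" and interior_E: "interior E \<noteq> {}"
    and full_cone: "\<lbrakk>x \<in> K; u \<in> normal_cone K x; \<forall>e\<in>E. u \<bullet> e < u \<bullet> x\<rbrakk>
      \<Longrightarrow> dim (normal_cone K x) = DIM('a)"
begin

definition apexes :: "'a set" where
  "apexes = {p \<in> K. dim (normal_cone K p) = DIM('a)}"

text \<open>One separating normal at \<open>p\<close> is enough: for \<open>p\<close> in
  \<open>K\<close>, \<open>cap_normal\<close> shows that every direction separating a point of the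
  cap from \<open>E\<close> is then normal at \<open>p\<close>.\<close>

definition cap :: "'a \<Rightarrow> 'a set" where
  "cap p = {w \<in> K. \<exists>u\<in>normal_cone K p. \<forall>e\<in>E. u \<bullet> e < u \<bullet> w}"

lemma E_nonempty: "E \<noteq> {}"
  using interior_E interior_subset by blast

lemma K_nonempty: "K \<noteq> {}"
  using E_nonempty E_subset_K by blast

lemma normal_coneD: "u \<in> normal_cone K p \<Longrightarrow> y \<in> K \<Longrightarrow> u \<bullet> y \<le> u \<bullet> p"
  by (simp add: normal_cone_def inner_diff_right)

text \<open>The midpoint of two distinct contact points would be a contact point, so its normal cone
  would be full. A normal there that is not orthogonal to \<open>x - y\<close> ranks one endpoint
  above the midpoint, which is impossible.\<close>

lemma face_unique:
  assumes "x \<in> K" "y \<in> K" "u \<in> normal_cone K x" "u \<in> normal_cone K y"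
    and sep: "\<forall>e\<in>E. u \<bullet> e < u \<bullet> x"
  shows "x = y"
proof (rule ccontr)
  assume "x \<noteq> y"
  define m where "m = midpoint x y"
  have "m \<in> K"
    using assms(1,2) convex_K unfolding m_def midpoint_def scaleR_add_right
    by (intro convexD) auto
  have "u \<bullet> x = u \<bullet> y"
    using assms by (meson antisym normal_coneD)
  then have um: "u \<bullet> m = u \<bullet> x"
    by (simp add: m_def midpoint_def inner_add_right)
  then have "u \<in> normal_cone K m"
    using assms(3) by (simp add: normal_cone_def inner_diff_right)
  then have "dim (normal_cone K m) = DIM('a)"
    using full_cone[OF \<open>m \<in> K\<close>] sep um by simp
  then obtain w where w: "w \<in> normal_cone K m" "w \<bullet> (x - y) \<noteq> 0"
    using full_normal_cone_not_orthogonal \<open>x \<noteq> y\<close> by (metis eq_iff_diff_eq_0)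
  have "w \<bullet> x \<le> w \<bullet> m" "w \<bullet> y \<le> w \<bullet> m"
    using w assms normal_coneD by blast+
  then show False
    using w(2) by (simp add: m_def midpoint_def inner_add_right inner_diff_right)
qed

text \<open>On the directions separating \<open>w\<close> from \<open>E\<close>, which form a convex set, the support function
  of \<open>K\<close> has a continuous gradient, the point of contact.
  Its values are apexes, so they form a countable connected set: a single point.\<close>

lemma cap_normal:
  assumes w: "w \<in> K" and p: "p \<in> K" and u: "u \<in> normal_cone K p"
    and "\<forall>e\<in>E. u \<bullet> e < u \<bullet> w" and "\<forall>e\<in>E. v \<bullet> e < v \<bullet> w"
  shows "v \<in> normal_cone K p"
proof -
  define S where "S = {u. \<forall>e\<in>E. u \<bullet> e < u \<bullet> w}"
  define top where "top u = (SOME x. x \<in> K \<and> u \<in> normal_cone K x)" for u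
  have top: "top u \<in> K" "u \<in> normal_cone K (top u)" for u
    using normal_cone_nonempty[OF compact_K K_nonempty, of u]
    by (metis (mono_tags, lifting) someI_ex top_def)+
  have sep: "\<forall>e\<in>E. u \<bullet> e < u \<bullet> top u" if "u \<in> S" for u
    using that normal_coneD[OF top(2) w, of u] by (fastforce simp: S_def)
  have top_eq: "top u = x" if "u \<in> S" "x \<in> K" "u \<in> normal_cone K x" for u x
    using face_unique top sep that by metis
  have "S = (\<Inter>e\<in>E. {u. (e - w) \<bullet> u < 0})"
    by (auto simp: S_def inner_commute inner_diff_right)
  then have "connected S"
    by (simp add: convex_INT convex_halfspace_lt convex_connected)
  moreover have "continuous_on S top"
  proof -
    \<comment> \<open>Being a contact point is a closed condition and, by \<open>top_eq\<close>,
      determines \<open>top\<close>. So the graph is closed, and compactness of \<open>K\<close>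
      turns this into continuity.\<close>
    have "(\<lambda>u. (u, top u)) ` S = S \<times> K \<inter> (\<Inter>y\<in>K. {z. fst z \<bullet> (y - snd z) \<le> 0})"
      using top top_eq by (auto simp: normal_cone_def image_iff)
    moreover have "closed (\<Inter>y\<in>K. {z :: 'a \<times> 'a. fst z \<bullet> (y - snd z) \<le> 0})"
      by (intro closed_INT ballI closed_Collect_le continuous_intros)
    ultimately have "closedin (top_of_set (S \<times> K)) ((\<lambda>u. (u, top u)) ` S)"
      by (simp add: closedin_closed_Int)
    then show ?thesis
      using continuous_closed_graph_eq[OF compact_K, of top S] top by blast
  qed
  ultimately have conn: "connected (top ` S)"
    using connected_continuous_image by blast
  have "top ` S \<subseteq> {p \<in> K. dim (normal_cone K p) = DIM('a)}"
    using top full_cone[OF top sep] by auto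
  then have "countable (top ` S)"
    using countable_full_normal_cones countable_subset by blast
  then have "top u = top v"
    using connected_uncountable[OF conn, of "top u" "top v"] assms(4,5) by (auto simp: S_def)
  moreover have "top u = p"
    using top_eq p u assms(4) by (simp add: S_def)
  ultimately show ?thesis
    using top(2)[of v] by simp
qed

text \<open>By \<open>cap_normal\<close>, a normal at \<open>p\<close> separating \<open>w\<close>
  from \<open>E\<close> is also a normal at \<open>q\<close>, and \<open>face_unique\<close> leaves
  only one point of contact.\<close>

lemma cap_apex_unique:
  assumes "w \<in> cap p" "w \<in> cap q" "p \<in> K" "q \<in> K"
  shows "p = q"
proof -
  obtain u where u: "u \<in> normal_cone K p" "\<forall>e\<in>E. u \<bullet> e < u \<bullet> w" and "w \<in> K"
    using assms(1) by (auto simp: cap_def)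
  obtain v where v: "v \<in> normal_cone K q" "\<forall>e\<in>E. v \<bullet> e < v \<bullet> w"
    using assms(2) by (auto simp: cap_def)
  have "u \<in> normal_cone K q"
    using cap_normal[OF \<open>w \<in> K\<close> \<open>q \<in> K\<close> v u(2)] .
  then show ?thesis
    using face_unique[OF assms(3,4) u(1)] u(2) normal_coneD[OF u(1) \<open>w \<in> K\<close>]
    by (meson less_le_trans)
qed

lemma cap_disjoint_E: "cap p \<inter> E = {}"
  by (auto simp: cap_def)

text \<open>A direction separating \<open>w\<close> from \<open>E\<close> attains its maximum over
  \<open>K\<close> at some \<open>p\<close>, which is at least as high as \<open>w\<close>; hence
  \<open>full_cone\<close> makes \<open>p\<close> an apex.\<close>

lemma Diff_eq_caps: "K - E = (\<Union>p\<in>apexes. cap p)"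
proof -
  have "\<exists>p\<in>apexes. w \<in> cap p" if "w \<in> K" "w \<notin> E" for w
  proof -
    obtain u where u: "\<forall>e\<in>E. u \<bullet> e < u \<bullet> w"
      using separating_direction convex_E compact_E \<open>w \<notin> E\<close> by metis
    obtain p where p: "p \<in> K" "u \<in> normal_cone K p"
      using normal_cone_nonempty compact_K K_nonempty by metis
    have "dim (normal_cone K p) = DIM('a)"
      using full_cone[OF p] u normal_coneD[OF p(2) \<open>w \<in> K\<close>] by (meson less_le_trans)
    then show ?thesis
      using p u \<open>w \<in> K\<close> by (auto simp: apexes_def cap_def)
  qed
  then show ?thesis
    using cap_disjoint_E by (auto simp: cap_def)
qed

lemma apex_in_K: "p \<in> apexes \<Longrightarrow> p \<in> K"
  by (simp add: apexes_def)

lemma countable_apexes: "countable apexes"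
  unfolding apexes_def by (rule countable_full_normal_cones)

lemma disjoint_caps: "disjoint_family_on cap apexes"
  using cap_apex_unique apex_in_K by (fastforce simp: disjoint_family_on_def)

lemma lmeasurable_K: "K \<in> lmeasurable" and lmeasurable_E: "E \<in> lmeasurable"
  using compact_K compact_E lmeasurable_compact by auto

lemma lmeasurable_cap: "cap p \<in> lmeasurable"
proof -
  \<comment> \<open>As \<open>E\<close> is compact, strict separation leaves room for a level
    \<open>b\<close>. This writes the cap as \<open>K\<close> cut with a union of open
    half-spaces.\<close>
  define H where "H = (\<Union>u\<in>normal_cone K p. \<Union>b\<in>{b. \<forall>e\<in>E. u \<bullet> e \<le> b}. {w. u \<bullet> w > b})"
  have "open H"
    unfolding H_def by (intro open_UN ballI open_halfspace_gt)
  moreover have "cap p = K \<inter> H"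
  proof -
    have "\<exists>b<u \<bullet> w. \<forall>e\<in>E. u \<bullet> e \<le> b" if sep: "\<forall>e\<in>E. u \<bullet> e < u \<bullet> w" for u w
    proof -
      obtain x where "x \<in> E" "u \<in> normal_cone E x"
        using normal_cone_nonempty[OF compact_E E_nonempty] .
      then show ?thesis
        using sep by (intro exI[of _ "u \<bullet> x"]) (auto simp: normal_cone_def inner_diff_right)
    qed
    then have "(\<forall>e\<in>E. u \<bullet> e < u \<bullet> w) \<longleftrightarrow> (\<exists>b<u \<bullet> w. \<forall>e\<in>E. u \<bullet> e \<le> b)" for u w
      by (meson le_less_trans)
    then show ?thesis
      by (auto simp: cap_def H_def)
  qed
  ultimately show ?thesis
    using lmeasurable_K by (simp add: fmeasurable_Int_fmeasurable)
qed

lemma emeasure_caps: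
  "(\<integral>\<^sup>+p. emeasure lebesgue (cap p) \<partial>count_space apexes)
     = ennreal (measure lebesgue K - measure lebesgue E)"
proof -
  have "(\<integral>\<^sup>+p. emeasure lebesgue (cap p) \<partial>count_space apexes) = emeasure lebesgue (K - E)"
    unfolding Diff_eq_caps using lmeasurable_cap
    by (intro emeasure_UN_countable[symmetric] disjoint_caps countable_apexes) auto
  also have "\<dots> = ennreal (measure lebesgue (K - E))"
    using lmeasurable_K lmeasurable_E by (simp add: emeasure_eq_measure2 fmeasurable_Diff)
  also have "measure lebesgue (K - E) = measure lebesgue K - measure lebesgue E"
    using lmeasurable_K lmeasurable_E E_subset_K by (simp add: measurable_measure_Diff)
  finally show ?thesis .
qed

text \<open>Otherwise some \<open>u\<close> separates \<open>w\<close> from both \<open>p\<close>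
  and \<open>E\<close>. By \<open>cap_normal\<close> this \<open>u\<close> is a normal at
  \<open>p\<close>, so \<open>w\<close> cannot be higher than \<open>p\<close>.\<close>

lemma cap_segment:
  assumes "p \<in> K" "w \<in> cap p"
  obtains a b e where "0 \<le> a" "0 \<le> b" "a + b = 1" "e \<in> E" "w = a *\<^sub>R p + b *\<^sub>R e"
proof -
  have "w \<in> convex hull (insert p E)"
  proof (rule ccontr)
    assume "w \<notin> convex hull (insert p E)"
    then obtain u where "\<forall>y\<in>convex hull (insert p E). u \<bullet> y < u \<bullet> w"
      using separating_direction[of "convex hull (insert p E)" w] compact_E
      by (auto simp: convex_convex_hull compact_convex_hull)
    then have u: "\<forall>e\<in>E. u \<bullet> e < u \<bullet> w" "u \<bullet> p < u \<bullet> w"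
      by (auto intro: hull_inc)
    moreover have "u \<in> normal_cone K p"
      using assms cap_normal u(1) unfolding cap_def by blast
    ultimately show False
      using normal_coneD[of u p w] assms(2) by (auto simp: cap_def)
  qed
  then show thesis
    using that by (auto simp: convex_hull_insert[OF E_nonempty] convex_hull_eq[THEN iffD2, OF convex_E])
qed

section \<open>Splitting the dilated body \<open>(1 + \<rho>) K\<close>\<close>

lemma add_scaleR_in_homothet:
  assumes "x \<in> K" "y \<in> K" "0 \<le> \<rho>"
  shows "x + \<rho> *\<^sub>R y \<in> homothet 0 (1 + \<rho>) K"
proof -
  define z where "z = (1 / (1 + \<rho>)) *\<^sub>R x + (\<rho> / (1 + \<rho>)) *\<^sub>R y"
  have "z \<in> K"
    unfolding z_def using assms by (intro convexD[OF convex_K]) (auto simp: field_simps)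
  moreover have "x + \<rho> *\<^sub>R y = (1 + \<rho>) *\<^sub>R z"
    using assms by (simp add: z_def scaleR_add_right)
  ultimately show ?thesis
    by (auto simp: homothet_def)
qed

text \<open>Write a point \<open>x\<close> of a cap as \<open>a p + b e\<close>. If \<open>b\<close>
  is large, \<open>\<rho> e\<close> can be split off from \<open>(1 + \<rho>) x\<close> and a point
  of \<open>K\<close> remains. Otherwise \<open>p\<close> is split off, and the rest is
  \<open>\<rho> w\<close> with \<open>w\<close> in \<open>E\<close> or in the cap of
  \<open>p\<close>.\<close>

lemma dilation_subset:
  assumes "0 < \<rho>"
  shows "homothet 0 (1 + \<rho>) K
    \<subseteq> (K + homothet 0 \<rho> E) \<union> (\<Union>p\<in>apexes. homothet p \<rho> (cap p))"
proof
  fix z assume "z \<in> homothet 0 (1 + \<rho>) K"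
  then obtain x where x: "x \<in> K" "z = (1 + \<rho>) *\<^sub>R x"
    by (auto simp: homothet_def)
  have sumI: "k + \<rho> *\<^sub>R e \<in> K + homothet 0 \<rho> E" if "k \<in> K" "e \<in> E" for k e
    using that by (auto simp: homothet_def set_plus_def)
  show "z \<in> (K + homothet 0 \<rho> E) \<union> (\<Union>p\<in>apexes. homothet p \<rho> (cap p))"
  proof (cases "x \<in> E")
    case True
    then show ?thesis
      using sumI[OF x(1) True] x(2) by (simp add: scaleR_add_left)
  next
    case False
    then obtain p where p: "p \<in> apexes" "x \<in> cap p"
      using x(1) Diff_eq_caps by blast
    then have "p \<in> K" by (simp add: apex_in_K)
    obtain a b e where ab: "0 \<le> a" "0 \<le> b" "a + b = 1" and e: "e \<in> E"
      and x_eq: "x = a *\<^sub>R p + b *\<^sub>R e"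
      using cap_segment[OF \<open>p \<in> K\<close> p(2)] .
    have a_eq: "a = 1 - b" and b_eq: "b = 1 - a" using ab by simp_all
    have "e \<in> K" using e E_subset_K by blast
    show ?thesis
    proof (cases "\<rho> \<le> (1 + \<rho>) * b")
      case True
      \<comment> \<open>This is \<open>z - \<rho> e\<close>; the case assumption makes the
        coefficient of \<open>e\<close> nonnegative.\<close>
      define k where "k = ((1 + \<rho>) * a) *\<^sub>R p + ((1 + \<rho>) * b - \<rho>) *\<^sub>R e"
      have "(1 + \<rho>) * a + ((1 + \<rho>) * b - \<rho>) = 1"
        by (simp add: a_eq algebra_simps)
      then have "k \<in> K"
        unfolding k_def using True ab assms \<open>p \<in> K\<close> \<open>e \<in> K\<close>
        by (intro convexD[OF convex_K]) auto
      moreover have "z = k + \<rho> *\<^sub>R e"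
        by (simp add: x x_eq k_def algebra_simps)
      ultimately show ?thesis
        using sumI[OF _ e] by simp
    next
      case False
      \<comment> \<open>The coefficients solve \<open>z = p + \<rho> w\<close>. The bound
        \<open>c \<le> a\<close> below says that \<open>w\<close> lies between \<open>e\<close> and
        \<open>x\<close>.\<close>
      define c where "c = ((1 + \<rho>) * a - 1) / \<rho>"
      define d where "d = (1 + \<rho>) * b / \<rho>"
      define w where "w = c *\<^sub>R p + d *\<^sub>R e"
      have cd: "0 \<le> c" "0 \<le> d" "c + d = 1" "c \<le> a"
        using False ab assms unfolding c_def d_def a_eq by (auto simp: field_simps)
      have "w \<in> K"
        unfolding w_def using cd \<open>p \<in> K\<close> \<open>e \<in> K\<close> by (intro convexD[OF convex_K]) auto
      have "\<rho> * c = (1 + \<rho>) * a - 1" "\<rho> * d = (1 + \<rho>) * b"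
        using assms by (simp_all add: c_def d_def)
      then have z_eq: "z = p + \<rho> *\<^sub>R w"
        by (simp add: x x_eq w_def scaleR_add_right scaleR_diff_left)
      show ?thesis
      proof (cases "w \<in> E")
        case True
        then show ?thesis
          using sumI[OF \<open>p \<in> K\<close>] z_eq by simp
      next
        case False
        obtain u where u: "\<forall>e\<in>E. u \<bullet> e < u \<bullet> w"
          using separating_direction convex_E compact_E False by metis
        have d_eq: "d = 1 - c" using cd by simp
        \<comment> \<open>Since \<open>w - e = c (p - e)\<close>, the direction \<open>u\<close>
          increases from \<open>e\<close> to \<open>p\<close>. So \<open>x\<close>, which is at
          least as near to \<open>p\<close> as \<open>w\<close>, is separated from \<open>E\<close>
          by \<open>u\<close> too, and \<open>cap_normal\<close> applies at
          \<open>x\<close>.\<close>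
        have "u \<bullet> e < u \<bullet> w" using u e by blast
        then have "0 < c * (u \<bullet> p - u \<bullet> e)"
          by (simp add: w_def d_eq algebra_simps)
        then have "u \<bullet> e < u \<bullet> p"
          using cd(1) by (simp add: zero_less_mult_iff)
        then have "c * (u \<bullet> p - u \<bullet> e) \<le> a * (u \<bullet> p - u \<bullet> e)"
          using cd(4) by (intro mult_right_mono) auto
        then have "u \<bullet> w \<le> u \<bullet> x"
          by (simp add: w_def x_eq d_eq b_eq algebra_simps)
        then have "\<forall>e\<in>E. u \<bullet> e < u \<bullet> x"
          using u by fastforce
        then have "u \<in> normal_cone K p"
          using p(2) cap_normal[OF x(1) \<open>p \<in> K\<close>] by (auto simp: cap_def)
        then have "w \<in> cap p"
          using u \<open>w \<in> K\<close> by (auto simp: cap_def)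
        then show ?thesis
          using p(1) z_eq by (auto simp: homothet_def)
      qed
    qed
  qed
qed

lemma dilation_decomposition:
  assumes "0 < \<rho>"
  shows "homothet 0 (1 + \<rho>) K
    = (K + homothet 0 \<rho> E) \<union> (\<Union>p\<in>apexes. homothet p \<rho> (cap p))"
proof
  have "k + \<rho> *\<^sub>R e \<in> homothet 0 (1 + \<rho>) K" if "k \<in> K" "e \<in> E" for k e
    using add_scaleR_in_homothet that assms E_subset_K by auto
  moreover have "p + \<rho> *\<^sub>R w \<in> homothet 0 (1 + \<rho>) K" if "p \<in> apexes" "w \<in> cap p" for p w
    using add_scaleR_in_homothet that assms apex_in_K by (auto simp: cap_def)
  ultimately show "(K + homothet 0 \<rho> E) \<union> (\<Union>p\<in>apexes. homothet p \<rho> (cap p))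
      \<subseteq> homothet 0 (1 + \<rho>) K"
    by (auto simp: homothet_def set_plus_def)
qed (rule dilation_subset[OF assms])

text \<open>For \<open>w\<close> in the cap, a normal \<open>u\<close> at \<open>p\<close>
  separating \<open>w\<close> from \<open>E\<close> gives
  \<open>u \<bullet> k \<le> u \<bullet> p\<close> and \<open>u \<bullet> e < u \<bullet> w\<close>.
  So \<open>p + \<rho> w\<close> is strictly higher than every \<open>k + \<rho> e\<close>.\<close>

lemma scaled_cap_disjoint_sum:
  assumes "0 < \<rho>" "p \<in> K"
  shows "(K + homothet 0 \<rho> E) \<inter> homothet p \<rho> (cap p) = {}"
proof (rule ccontr)
  assume "\<not> ?thesis"
  then obtain k e w where "k \<in> K" "e \<in> E" "w \<in> cap p" and eq: "p + \<rho> *\<^sub>R w = k + \<rho> *\<^sub>R e"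
    by (auto simp: homothet_def set_plus_def)
  then obtain u where u: "u \<in> normal_cone K p" "u \<bullet> e < u \<bullet> w"
    by (auto simp: cap_def)
  have "u \<bullet> p + \<rho> * (u \<bullet> w) = u \<bullet> k + \<rho> * (u \<bullet> e)"
    using arg_cong[OF eq, of "(\<bullet>) u"] by (simp add: inner_add_right)
  moreover have "u \<bullet> k \<le> u \<bullet> p"
    using normal_coneD u(1) \<open>k \<in> K\<close> .
  moreover have "\<rho> * (u \<bullet> e) < \<rho> * (u \<bullet> w)"
    using u(2) assms by simp
  ultimately show False by linarith
qed

text \<open>If \<open>p + \<rho> w = q + \<rho> v\<close>, a normal at \<open>p\<close> ranks
  \<open>q\<close> no higher than \<open>p\<close>, hence \<open>v\<close> no lower than
  \<open>w\<close>. Then \<open>v\<close> lies in the cap of \<open>p\<close> as well, against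
  \<open>cap_apex_unique\<close>.\<close>

lemma disjoint_scaled_caps:
  assumes "0 < \<rho>"
  shows "disjoint_family_on (\<lambda>p. homothet p \<rho> (cap p)) apexes"
  unfolding disjoint_family_on_def
proof (intro ballI impI, rule ccontr)
  fix p q assume pq: "p \<in> apexes" "q \<in> apexes" "p \<noteq> q"
    and "homothet p \<rho> (cap p) \<inter> homothet q \<rho> (cap q) \<noteq> {}"
  then obtain w v where w: "w \<in> cap p" and v: "v \<in> cap q"
    and eq: "p + \<rho> *\<^sub>R w = q + \<rho> *\<^sub>R v"
    by (auto simp: homothet_def)
  have K: "p \<in> K" "q \<in> K" "v \<in> K"
    using pq v apex_in_K by (auto simp: cap_def)
  obtain u where u: "u \<in> normal_cone K p" "\<forall>e\<in>E. u \<bullet> e < u \<bullet> w"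
    using w by (auto simp: cap_def)
  have "u \<bullet> p + \<rho> * (u \<bullet> w) = u \<bullet> q + \<rho> * (u \<bullet> v)"
    using arg_cong[OF eq, of "(\<bullet>) u"] by (simp add: inner_add_right)
  moreover have "u \<bullet> q \<le> u \<bullet> p"
    using normal_coneD u(1) K(2) .
  ultimately have "\<rho> * (u \<bullet> w) \<le> \<rho> * (u \<bullet> v)" by linarith
  then have "u \<bullet> w \<le> u \<bullet> v" using assms by simp
  then have "\<forall>e\<in>E. u \<bullet> e < u \<bullet> v"
    using u(2) by force
  then have "v \<in> cap p"
    using u(1) K by (auto simp: cap_def)
  then show False
    using cap_apex_unique v K pq(3) by blast
qed

section \<open>Volume of the outer parallel body\<close>

lemma lmeasurable_sum: "K + homothet 0 \<rho> E \<in> lmeasurable"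
proof -
  have "compact (homothet 0 \<rho> E)"
    unfolding homothet_def using compact_E
    by (intro compact_continuous_image continuous_intros)
  then have "compact {x + y |x y. x \<in> K \<and> y \<in> homothet 0 \<rho> E}"
    by (rule compact_sums[OF compact_K])
  also have "{x + y |x y. x \<in> K \<and> y \<in> homothet 0 \<rho> E} = K + homothet 0 \<rho> E"
    by (auto simp: set_plus_def)
  finally have "compact (K + homothet 0 \<rho> E)" .
  then show ?thesis by (rule lmeasurable_compact)
qed

lemma measure_E_pos: "0 < measure lebesgue E"
proof -
  have "\<not> negligible E"
    using interior_E negligible_convex_interior[OF convex_E] by simp
  then have "measure lebesgue E \<noteq> 0"
    using lmeasurable_E negligible_iff_measure by blast
  then show ?thesis
    by (simp add: zero_less_measure_iff)
qed

lemma measure_E_le_K: "measure lebesgue E \<le> measure lebesgue K"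
  using E_subset_K lmeasurable_E lmeasurable_K by (intro measure_mono_fmeasurable) auto

text \<open>Volumes are compared in \<open>dilation_decomposition\<close>, where the rescaled caps
  contribute \<open>\<rho> ^ n\<close> times the volume of \<open>K - E\<close>. The decomposition
  is available for \<open>0 < \<rho>\<close>, so \<open>\<rho> = 0\<close> is treated apart.\<close>

theorem measure_outer_parallel_body:
  assumes "0 \<le> \<rho>"
  shows "measure lebesgue (K + homothet 0 \<rho> E)
    = measure lebesgue K * (1 + \<rho>) ^ DIM('a)
      - (measure lebesgue K - measure lebesgue E) * \<rho> ^ DIM('a)"
proof (cases "\<rho> = 0")
  case True
  have "homothet 0 0 E = {0}"
    using E_nonempty by (auto simp: homothet_def)
  then have "K + homothet 0 0 E = K"
    by (auto simp: set_plus_def)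
  then show ?thesis
    using True by (simp add: zero_power)
next
  case False
  then have "0 < \<rho>" using assms by simp
  let ?A = "K + homothet 0 \<rho> E" and ?C = "\<Union>p\<in>apexes. homothet p \<rho> (cap p)"
  let ?d = "measure lebesgue K - measure lebesgue E"
  have cap_meas: "homothet p \<rho> (cap p) \<in> sets lebesgue" for p
    using homothet_lmeasurable[OF lmeasurable_cap] by blast
  have "emeasure lebesgue ?C
      = (\<integral>\<^sup>+p. emeasure lebesgue (homothet p \<rho> (cap p)) \<partial>count_space apexes)"
    by (intro emeasure_UN_countable cap_meas countable_apexes disjoint_scaled_caps \<open>0 < \<rho>\<close>)
  also have "\<dots> = ennreal (\<rho> ^ DIM('a)) * (\<integral>\<^sup>+p. emeasure lebesgue (cap p) \<partial>count_space apexes)"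
    by (simp add: emeasure_homothet[OF assms] nn_integral_cmult)
  also have "\<dots> = ennreal (\<rho> ^ DIM('a) * ?d)"
    using assms measure_E_le_K by (simp add: emeasure_caps ennreal_mult)
  finally have C: "emeasure lebesgue ?C = ennreal (\<rho> ^ DIM('a) * ?d)" .
  have "ennreal ((1 + \<rho>) ^ DIM('a) * measure lebesgue K)
      = emeasure lebesgue (homothet 0 (1 + \<rho>) K)"
    using assms lmeasurable_K
    by (simp add: emeasure_homothet emeasure_eq_measure2 ennreal_mult)
  also have "\<dots> = emeasure lebesgue (?A \<union> ?C)"
    by (simp add: dilation_decomposition[OF \<open>0 < \<rho>\<close>])
  also have "\<dots> = emeasure lebesgue ?A + emeasure lebesgue ?C"
    using lmeasurable_sum cap_meas countable_apexes
      scaled_cap_disjoint_sum[OF \<open>0 < \<rho>\<close> apex_in_K]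
    by (intro plus_emeasure[symmetric] sets.countable_UN'') auto
  also have "\<dots> = ennreal (measure lebesgue ?A + \<rho> ^ DIM('a) * ?d)"
    using C lmeasurable_sum assms measure_E_le_K by (simp add: emeasure_eq_measure2)
  finally have "(1 + \<rho>) ^ DIM('a) * measure lebesgue K
      = measure lebesgue ?A + \<rho> ^ DIM('a) * ?d"
    using assms measure_E_le_K by (subst (asm) ennreal_inj) auto
  then show ?thesis by (simp add: algebra_simps)
qed

section \<open>Homothets of \<open>E\<close> around and inside \<open>K\<close>\<close>

text \<open>The sets \<open>F p\<close> have too little total volume to cover \<open>K\<close>. An
  uncovered \<open>y\<close> satisfies \<open>(1 - b) x + b y \<in> E\<close> for all
  \<open>x\<close> in \<open>K\<close>, and solving for \<open>x\<close> gives the homothet.\<close>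

lemma exists_circumscribed_homothet:
  assumes b: "0 < b" "b < 1"
    and vol: "measure lebesgue K - measure lebesgue E < b ^ DIM('a) * measure lebesgue K"
  shows "\<exists>x. K \<subseteq> homothet x (1 / (1 - b)) E"
proof -
  \<comment> \<open>A point \<open>y\<close> lies in \<open>F p\<close> exactly when
    \<open>(1 - b) p + b y\<close> lies in the cap of \<open>p\<close>.\<close>
  define F where "F p = homothet ((1 - 1 / b) *\<^sub>R p) (1 / b) (cap p)" for p
  have F_meas: "F p \<in> sets lebesgue" for p
    unfolding F_def using homothet_lmeasurable[OF lmeasurable_cap] by blast
  have "emeasure lebesgue (\<Union>(F ` apexes))
      \<le> (\<integral>\<^sup>+p. emeasure lebesgue (F p) \<partial>count_space apexes)"
    by (intro emeasure_UN_countable_le F_meas countable_apexes)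
  also have "\<dots> = ennreal ((1 / b) ^ DIM('a)) * (\<integral>\<^sup>+p. emeasure lebesgue (cap p) \<partial>count_space apexes)"
    using b by (simp add: F_def emeasure_homothet nn_integral_cmult)
  also have "\<dots> = ennreal ((1 / b) ^ DIM('a) * (measure lebesgue K - measure lebesgue E))"
    using b measure_E_le_K by (simp add: emeasure_caps ennreal_mult)
  also have "\<dots> < ennreal (measure lebesgue K)"
    using b vol measure_E_le_K measure_E_pos
    by (intro ennreal_lessI) (auto simp: field_simps power_divide)
  also have "\<dots> = emeasure lebesgue K"
    using lmeasurable_K by (simp add: emeasure_eq_measure2)
  finally have "emeasure lebesgue (\<Union>(F ` apexes)) < emeasure lebesgue K" .
  moreover have "\<Union>(F ` apexes) \<in> sets lebesgue"
    by (intro sets.countable_UN'' F_meas countable_apexes)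
  ultimately have "\<not> K \<subseteq> \<Union>(F ` apexes)"
    using emeasure_mono leD by metis
  then obtain y where y: "y \<in> K" "y \<notin> \<Union>(F ` apexes)" by blast
  have in_E: "(1 - b) *\<^sub>R x + b *\<^sub>R y \<in> E" if "x \<in> K" for x
  proof (rule ccontr)
    let ?w = "(1 - b) *\<^sub>R x + b *\<^sub>R y"
    assume "?w \<notin> E"
    moreover have "?w \<in> K"
      using b y that by (intro convexD[OF convex_K]) auto
    ultimately obtain p where p: "p \<in> apexes" "?w \<in> cap p"
      using Diff_eq_caps by blast
    then obtain u where u: "u \<in> normal_cone K p" "\<forall>e\<in>E. u \<bullet> e < u \<bullet> ?w"
      by (auto simp: cap_def)
    \<comment> \<open>Replacing \<open>x\<close> by the apex does not lower the point in direction
      \<open>u\<close>, so it stays in the cap of \<open>p\<close>; this puts \<open>y\<close> into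
      \<open>F p\<close>.\<close>
    let ?v = "(1 - b) *\<^sub>R p + b *\<^sub>R y"
    have "(1 - b) * (u \<bullet> x) \<le> (1 - b) * (u \<bullet> p)"
      using normal_coneD[OF u(1) that] b by (intro mult_left_mono) auto
    then have "u \<bullet> ?w \<le> u \<bullet> ?v"
      by (simp add: inner_add_right)
    moreover have "?v \<in> K"
      using b y apex_in_K[OF p(1)] by (intro convexD[OF convex_K]) auto
    moreover from calculation(1) have "\<forall>e\<in>E. u \<bullet> e < u \<bullet> ?v"
      using u(2) by force
    ultimately have "?v \<in> cap p"
      using u(1) by (auto simp: cap_def)
    moreover have "y = (1 - 1 / b) *\<^sub>R p + (1 / b) *\<^sub>R ?v"
      using b by (simp add: scaleR_add_right algebra_simps diff_divide_distrib)
    ultimately have "y \<in> F p"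
      unfolding F_def homothet_def by blast
    then show False
      using y p by blast
  qed
  have "x = (- b / (1 - b)) *\<^sub>R y + (1 / (1 - b)) *\<^sub>R ((1 - b) *\<^sub>R x + b *\<^sub>R y)" for x
    using b by (simp add: scaleR_add_right)
  then have "K \<subseteq> homothet ((- b / (1 - b)) *\<^sub>R y) (1 / (1 - b)) E"
    using in_E unfolding homothet_def by blast
  then show ?thesis by blast
qed

text \<open>A factor below \<open>1\<close> would give a homothet of smaller volume than
  \<open>E\<close>, hence than \<open>K\<close>.\<close>

lemma circumscribed_homothet_factor:
  assumes "0 \<le> R" "K \<subseteq> homothet x R E"
  shows "1 \<le> R"
proof (rule ccontr)
  assume "\<not> 1 \<le> R"
  have "measure lebesgue K \<le> R ^ DIM('a) * measure lebesgue E"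
    using assms lmeasurable_K homothet_lmeasurable[OF lmeasurable_E]
    by (subst measure_homothet[symmetric, of _ _ x]) (auto intro!: measure_mono_fmeasurable)
  moreover have "R ^ DIM('a) < 1"
    using assms \<open>\<not> 1 \<le> R\<close> by (simp add: power_less_one_iff)
  ultimately have "measure lebesgue K < measure lebesgue E"
    using measure_E_pos by (smt (verit) mult_less_cancel_right2)
  then show False
    using measure_E_le_K by simp
qed

text \<open>If \<open>x + r E \<subseteq> K\<close>, then \<open>K + \<rho> E\<close> lies in a translate of \<open>(1 + \<rho> / r) K\<close>.
  Comparing volumes to first order at \<open>\<rho> = 0\<close> gives \<open>r \<le> 1\<close>;
  in dimension 1 the term \<open>\<rho> ^ DIM('a)\<close> would interfere.\<close>

lemma inscribed_homothet_factor:
  assumes dim: "2 \<le> DIM('a)" and sub: "homothet x r E \<subseteq> K"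
  shows "r \<le> 1"
proof (rule ccontr)
  assume "\<not> r \<le> 1"
  then have r: "1 < r" by simp
  \<comment> \<open>Chosen so that the first-order gain \<open>\<rho> (1 - 1 / r)\<close> equals
    \<open>2 * \<rho> ^ 2\<close> and beats the error \<open>\<rho> ^ n\<close>, which is at most
    \<open>\<rho> ^ 2\<close>.\<close>
  define \<rho> where "\<rho> = (1 - 1 / r) / 2"
  have \<rho>: "0 < \<rho>" "\<rho> < 1" "1 - 1 / r = 2 * \<rho>"
    using r by (auto simp: \<rho>_def field_simps)
  have "K + homothet 0 \<rho> E \<subseteq> homothet (- (\<rho> / r) *\<^sub>R x) (1 + \<rho> / r) K"
  proof -
    have "k + \<rho> *\<^sub>R e \<in> homothet (- (\<rho> / r) *\<^sub>R x) (1 + \<rho> / r) K" if "k \<in> K" "e \<in> E" for k e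
    proof -
      have "x + r *\<^sub>R e \<in> K"
        using sub \<open>e \<in> E\<close> by (auto simp: homothet_def)
      then have "k + (\<rho> / r) *\<^sub>R (x + r *\<^sub>R e) \<in> homothet 0 (1 + \<rho> / r) K"
        using add_scaleR_in_homothet \<open>k \<in> K\<close> \<rho> r by simp
      then obtain z where "z \<in> K" "k + (\<rho> / r) *\<^sub>R (x + r *\<^sub>R e) = (1 + \<rho> / r) *\<^sub>R z"
        by (auto simp: homothet_def)
      moreover from this have "k + \<rho> *\<^sub>R e = - (\<rho> / r) *\<^sub>R x + (1 + \<rho> / r) *\<^sub>R z"
        using r by (simp add: scaleR_add_right algebra_simps)
      ultimately show ?thesis
        unfolding homothet_def by blast
    qed
    then show ?thesis
      by (auto simp: homothet_def set_plus_def)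
  qed
  then have "measure lebesgue (K + homothet 0 \<rho> E)
      \<le> measure lebesgue (homothet (- (\<rho> / r) *\<^sub>R x) (1 + \<rho> / r) K)"
    using lmeasurable_sum homothet_lmeasurable[OF lmeasurable_K]
    by (intro measure_mono_fmeasurable) auto
  also have "\<dots> = (1 + \<rho> / r) ^ DIM('a) * measure lebesgue K"
    using \<rho> r by (simp add: measure_homothet)
  finally have "measure lebesgue K * (1 + \<rho>) ^ DIM('a)
      - (measure lebesgue K - measure lebesgue E) * \<rho> ^ DIM('a)
      \<le> measure lebesgue K * (1 + \<rho> / r) ^ DIM('a)"
    using \<rho> by (simp add: measure_outer_parallel_body mult.commute)
  moreover have "0 < measure lebesgue E * \<rho> ^ DIM('a)"
    using measure_E_pos \<rho> by simp
  ultimately have "measure lebesgue K * ((1 + \<rho>) ^ DIM('a) - (1 + \<rho> / r) ^ DIM('a))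
      < measure lebesgue K * \<rho> ^ DIM('a)"
    by (simp add: algebra_simps)
  then have "(1 + \<rho>) ^ DIM('a) - (1 + \<rho> / r) ^ DIM('a) < \<rho> ^ DIM('a)"
    using measure_E_pos measure_E_le_K by simp
  also have "\<dots> \<le> \<rho> ^ 2"
    using \<rho> dim by (intro power_decreasing) auto
  also have "\<dots> \<le> 2 * \<rho> ^ 2" by simp
  also have "\<dots> = (1 + \<rho>) - (1 + \<rho> / r)"
  proof -
    have "\<rho> * (1 - 1 / r) = 2 * \<rho> ^ 2"
      by (simp only: \<rho>(3) power2_eq_square)
    then show ?thesis
      by (simp add: right_diff_distrib)
  qed
  also have "\<dots> \<le> (1 + \<rho>) ^ DIM('a) - (1 + \<rho> / r) ^ DIM('a)"
  proof -
    \<comment> \<open>For \<open>1 \<le> B \<le> A\<close>, the difference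
      \<open>A ^ n - B ^ n\<close> is at least \<open>(A - B) * B ^ (n - 1)\<close>, hence at least
      \<open>A - B\<close>.\<close>
    obtain m where m: "DIM('a) = Suc m"
      using dim by (cases "DIM('a)") auto
    have ge1: "1 \<le> (1 + \<rho> / r) ^ m"
      using \<rho> r by (intro one_le_power) auto
    have "(1 + \<rho> / r) ^ m \<le> (1 + \<rho>) ^ m"
      using \<rho> r by (intro power_mono) (auto simp: field_simps)
    then have "(1 + \<rho>) * (1 + \<rho> / r) ^ m \<le> (1 + \<rho>) * (1 + \<rho>) ^ m"
      using \<rho> by (intro mult_left_mono) auto
    moreover have "(\<rho> - \<rho> / r) * 1 \<le> (\<rho> - \<rho> / r) * (1 + \<rho> / r) ^ m"
      using ge1 \<rho> r by (intro mult_left_mono) (auto simp: field_simps)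
    ultimately show ?thesis
      by (simp add: m algebra_simps)
  qed
  finally show False by simp
qed

lemma relative_inradius_eq_1:
  assumes "2 \<le> DIM('a)"
  shows "relative_inradius K E = 1"
  unfolding relative_inradius_def
proof (rule Greatest_equality)
  show "0 \<le> (1::real) \<and> (\<exists>x. homothet x 1 E \<subseteq> K)"
    using E_subset_K by (auto simp: homothet_def intro!: exI[of _ 0])
qed (use inscribed_homothet_factor[OF assms] in auto)

text \<open>\<open>LEAST\<close> over the reals requires the infimum to be attained. The admissible
  factors are at least \<open>1\<close>, exist by \<open>exists_circumscribed_homothet\<close>, and
  form a closed set because the translation vectors stay bounded.\<close>

lemma relative_circumradius_attained:
  obtains x where "1 \<le> relative_circumradius K E" "K \<subseteq> homothet x (relative_circumradius K E) E"
    and "\<And>R y. \<lbrakk>0 \<le> R; K \<subseteq> homothet y R E\<rbrakk> \<Longrightarrow> relative_circumradius K E \<le> R"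
proof -
  define A where "A = {R. 0 \<le> R \<and> (\<exists>x. K \<subseteq> homothet x R E)}"
  have A_ge: "1 \<le> R" if "R \<in> A" for R
    using that circumscribed_homothet_factor by (auto simp: A_def)
  have "closed A"
    unfolding closed_sequential_limits
  proof (intro allI impI, elim conjE)
    fix R :: "nat \<Rightarrow> real" and r
    assume R: "\<forall>n. R n \<in> A" and lim: "R \<longlonglongrightarrow> r"
    have "1 \<le> r"
      using A_ge R by (intro LIMSEQ_le_const[OF lim]) auto
    have "\<forall>n. \<exists>x. K \<subseteq> homothet x (R n) E"
      using R by (auto simp: A_def)
    then obtain x where x: "\<And>n. K \<subseteq> homothet (x n) (R n) E"
      by metis
    obtain k where "k \<in> K" using K_nonempty by blast
    obtain B where B: "\<And>n. \<bar>R n\<bar> \<le> B"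
      using convergent_imp_bounded[OF lim] by (auto simp: bounded_iff)
    obtain C where C: "\<And>e. e \<in> E \<Longrightarrow> norm e \<le> C"
      using compact_imp_bounded[OF compact_E] by (auto simp: bounded_iff)
    \<comment> \<open>One point of \<open>K\<close> controls the translations:
      \<open>k = x n + R n e\<close> with both \<open>R n\<close> and \<open>e\<close>
      bounded.\<close>
    have "norm (x n) \<le> norm k + B * C" for n
    proof -
      obtain e where "e \<in> E" "k = x n + R n *\<^sub>R e"
        using x[of n] \<open>k \<in> K\<close> by (auto simp: homothet_def)
      then have "x n = k - R n *\<^sub>R e" by simp
      then have "norm (x n) \<le> norm k + \<bar>R n\<bar> * norm e"
        by (metis norm_scaleR norm_triangle_ineq4)
      also have "\<dots> \<le> norm k + B * C"
        using B[of n] C[OF \<open>e \<in> E\<close>] by (intro add_left_mono mult_mono) (auto intro: order_trans)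
      finally show ?thesis .
    qed
    then have "bounded (range x)"
      by (auto simp: bounded_iff)
    then obtain l s where s: "strict_mono s" "(x \<circ> s) \<longlonglongrightarrow> l"
      using bounded_imp_convergent_subsequence by blast
    have lim_s: "(R \<circ> s) \<longlonglongrightarrow> r"
      using LIMSEQ_subseq_LIMSEQ[OF lim s(1)] .
    have "y \<in> homothet l r E" if "y \<in> K" for y
    proof -
      \<comment> \<open>Factors of at least \<open>1\<close> permit division. This moves the
        inclusion into the fixed closed set \<open>E\<close>, where the limit can be taken.\<close>
      have "(1 / R n) *\<^sub>R (y - x n) \<in> E" for n
      proof -
        obtain e where "e \<in> E" "y = x n + R n *\<^sub>R e"
          using x[of n] \<open>y \<in> K\<close> by (auto simp: homothet_def)
        then show ?thesis
          using A_ge[of "R n"] R by auto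
      qed
      moreover have "(\<lambda>n. (1 / (R \<circ> s) n) *\<^sub>R (y - (x \<circ> s) n)) \<longlonglongrightarrow> (1 / r) *\<^sub>R (y - l)"
        using \<open>1 \<le> r\<close> by (intro tendsto_intros lim_s s) auto
      ultimately have "(1 / r) *\<^sub>R (y - l) \<in> E"
        using closed_sequentially[OF compact_imp_closed[OF compact_E]] by fastforce
      moreover have "y = l + r *\<^sub>R ((1 / r) *\<^sub>R (y - l))"
        using \<open>1 \<le> r\<close> by simp
      ultimately show ?thesis
        unfolding homothet_def by blast
    qed
    then show "r \<in> A"
      using \<open>1 \<le> r\<close> by (auto simp: A_def)
  qed
  have "A \<noteq> {}"
  proof -
    \<comment> \<open>Any \<open>b\<close> in \<open>(0, 1)\<close> with \<open>b ^ n\<close> above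
      \<open>1 - V(E) / V(K)\<close> would do; halving \<open>V(E)\<close> makes the inequality
      strict.\<close>
    define b where "b = root DIM('a) (1 - measure lebesgue E / (2 * measure lebesgue K))"
    have "0 < measure lebesgue K"
      using measure_E_pos measure_E_le_K by linarith
    then have b: "0 < b" "b < 1" "b ^ DIM('a) = 1 - measure lebesgue E / (2 * measure lebesgue K)"
      using measure_E_pos measure_E_le_K by (auto simp: b_def field_simps)
    then have "measure lebesgue K - measure lebesgue E < b ^ DIM('a) * measure lebesgue K"
      using measure_E_pos \<open>0 < measure lebesgue K\<close> by (simp add: field_simps)
    then have "1 / (1 - b) \<in> A"
      using exists_circumscribed_homothet b by (auto simp: A_def)
    then show ?thesis by blast
  qed
  have bdd: "bdd_below A"
    using A_ge by (meson bdd_belowI)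
  have "Inf A \<in> A"
    using closed_contains_Inf[OF \<open>A \<noteq> {}\<close> bdd \<open>closed A\<close>] .
  moreover have le: "Inf A \<le> R" if "R \<in> A" for R
    using cInf_lower[OF that bdd] .
  ultimately have "relative_circumradius K E = Inf A"
    unfolding relative_circumradius_def by (intro Least_equality) (auto simp: A_def)
  then show thesis
    using that \<open>Inf A \<in> A\<close> le A_ge by (auto simp: A_def)
qed

lemma relative_circumradius_ge_1: "1 \<le> relative_circumradius K E"
  using relative_circumradius_attained by blast

text \<open>\<open>exists_circumscribed_homothet\<close> needs a strict volume bound, so
  \<open>1 / (1 - \<beta>)\<close> is only approached, through factors \<open>1 / (1 - b)\<close>
  with \<open>b\<close> slightly above \<open>\<beta>\<close>.\<close>

lemma relative_circumradius_le:
  assumes \<beta>: "0 \<le> \<beta>" "\<beta> < 1"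
    and vol: "\<beta> ^ DIM('a) * measure lebesgue K = measure lebesgue K - measure lebesgue E"
  shows "relative_circumradius K E \<le> 1 / (1 - \<beta>)"
proof (rule ccontr)
  define R where "R = relative_circumradius K E"
  assume "\<not> ?thesis"
  then have "1 / (1 - \<beta>) < R" by (simp add: R_def)
  have "1 \<le> R"
    using relative_circumradius_ge_1 by (simp add: R_def)
  have "\<beta> < 1 - 1 / R"
    using \<open>1 / (1 - \<beta>) < R\<close> \<open>1 \<le> R\<close> \<beta> by (simp add: field_simps)
  then obtain b where b: "\<beta> < b" "b < 1 - 1 / R"
    using dense by blast
  have "b < 1"
    using b(2) \<open>1 \<le> R\<close> by (smt (verit) zero_less_divide_1_iff)
  have "\<beta> ^ DIM('a) < b ^ DIM('a)"
    using \<beta> b by (intro power_strict_mono) auto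
  then have "measure lebesgue K - measure lebesgue E < b ^ DIM('a) * measure lebesgue K"
    unfolding vol[symmetric] using measure_E_pos measure_E_le_K by simp
  then obtain x where "K \<subseteq> homothet x (1 / (1 - b)) E"
    using exists_circumscribed_homothet b \<beta> \<open>b < 1\<close> by force
  then have "R \<le> 1 / (1 - b)"
    using relative_circumradius_attained \<open>b < 1\<close> unfolding R_def
    by (metis diff_gt_0_iff_gt less_eq_real_def zero_less_divide_1_iff)
  then show False
    using b(2) \<open>1 \<le> R\<close> \<open>b < 1\<close> by (simp add: field_simps)
qed

end

section \<open>The Steiner polynomial and its roots\<close>

text \<open>Stated for commutative rings because it serves twice: over the reals for the Steiner
  formula and over the complex numbers for the polynomial.\<close>

lemma binomial_sum_top_coeff:
  fixes a b x :: "'b::comm_ring_1"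
  shows "(\<Sum>i\<le>n. of_nat (n choose i) * (if i < n then a else b) * x ^ i)
    = a * (1 + x) ^ n - (a - b) * x ^ n"
proof -
  have "(\<Sum>i\<le>n. of_nat (n choose i) * (if i < n then a else b) * x ^ i)
      = (\<Sum>i\<le>n. a * (of_nat (n choose i) * x ^ i) - (if i = n then (a - b) * x ^ n else 0))"
    by (intro sum.cong) (auto simp: algebra_simps)
  also have "\<dots> = a * (x + 1) ^ n - (a - b) * x ^ n"
    by (simp add: sum_subtractf binomial_ring flip: sum_distrib_left)
  finally show ?thesis by (simp add: add.commute)
qed

context cap_body
begin

lemma quermassintegral_cap_body:
  assumes "i \<le> DIM('a)"
  shows "quermassintegral K E i
    = (if i < DIM('a) then measure lebesgue K else measure lebesgue E)"
proof -
  have "steiner_coeffs K E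
      (\<lambda>i. if i < DIM('a) then measure lebesgue K else measure lebesgue E)"
    unfolding steiner_coeffs_def
    by (simp add: measure_outer_parallel_body binomial_sum_top_coeff)
  then show ?thesis
    using quermassintegral_eq assms by blast
qed

lemma poly_steiner_poly:
  "poly (steiner_poly K E) s
    = of_real (measure lebesgue K) * (1 + s) ^ DIM('a)
      - of_real (measure lebesgue K - measure lebesgue E) * s ^ DIM('a)"
proof -
  have "poly (steiner_poly K E) s
      = (\<Sum>i\<le>DIM('a). of_nat (DIM('a) choose i) *
          (if i < DIM('a) then of_real (measure lebesgue K) else of_real (measure lebesgue E)) * s ^ i)"
    unfolding steiner_poly_def poly_sum
    by (intro sum.cong) (auto simp: quermassintegral_cap_body poly_monom)
  then show ?thesis
    by (simp add: binomial_sum_top_coeff)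
qed

lemma degree_steiner_poly: "degree (steiner_poly K E) = DIM('a)"
proof (rule antisym)
  show "degree (steiner_poly K E) \<le> DIM('a)"
    unfolding steiner_poly_def by (intro degree_sum_le) (auto intro: order_trans[OF degree_monom_le])
  have "coeff (steiner_poly K E) DIM('a) = of_real (quermassintegral K E DIM('a))"
    by (simp add: steiner_poly_def coeff_sum)
  then have "coeff (steiner_poly K E) DIM('a) = of_real (measure lebesgue E)"
    by (simp add: quermassintegral_cap_body)
  then show "DIM('a) \<le> degree (steiner_poly K E)"
    using measure_E_pos by (intro le_degree) simp
qed

text \<open>The value solves \<open>1 + s = \<beta> \<omega> s\<close>, and \<open>n\<close>-th
  powers eliminate \<open>\<omega>\<close>. The denominator is nonzero because
  \<open>\<omega>\<close> has norm \<open>1\<close> and \<open>\<beta> < 1\<close>.\<close>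

lemma steiner_root:
  assumes \<beta>: "0 \<le> \<beta>" "\<beta> < 1"
    and vol: "\<beta> ^ DIM('a) * measure lebesgue K = measure lebesgue K - measure lebesgue E"
    and \<omega>: "\<omega> ^ DIM('a) = 1"
  shows "poly (steiner_poly K E) (- 1 / (1 - of_real \<beta> * \<omega>)) = 0"
proof -
  define s where "s = - 1 / (1 - of_real \<beta> * \<omega>)"
  have "norm \<omega> = 1"
    using \<omega> by (metis DIM_positive norm_ge_zero norm_one norm_power power_eq_1_iff less_not_refl)
  then have "norm (of_real \<beta> * \<omega>) < 1"
    using \<beta> by (simp add: norm_mult)
  then have "1 - of_real \<beta> * \<omega> \<noteq> 0" by auto
  then have "1 + s = of_real \<beta> * \<omega> * s"
    by (simp add: s_def field_simps)
  then have "(1 + s) ^ DIM('a) = of_real (\<beta> ^ DIM('a)) * s ^ DIM('a)"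
    using \<omega> by (simp add: power_mult_distrib)
  then show ?thesis
    unfolding s_def[symmetric] poly_steiner_poly vol[symmetric] by simp
qed

text \<open>Norms in the root equation give \<open>norm (1 + s) \<le> norm s\<close>: a root is at
  least as close to \<open>- 1\<close> as to \<open>0\<close>.\<close>

lemma Re_steiner_root_nonpos:
  assumes "poly (steiner_poly K E) s = 0"
  shows "Re s \<le> 0"
proof -
  have pos: "0 < measure lebesgue K"
    using measure_E_pos measure_E_le_K by linarith
  have "of_real (measure lebesgue K) * (1 + s) ^ DIM('a)
      = of_real (measure lebesgue K - measure lebesgue E) * s ^ DIM('a)"
    using assms by (simp add: poly_steiner_poly)
  then have "measure lebesgue K * norm (1 + s) ^ DIM('a)
      = (measure lebesgue K - measure lebesgue E) * norm s ^ DIM('a)"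
    using measure_E_le_K by (metis abs_of_nonneg diff_ge_0_iff_ge less_eq_real_def norm_mult norm_of_real norm_power pos)
  also have "\<dots> \<le> measure lebesgue K * norm s ^ DIM('a)"
    using measure_E_pos by (intro mult_right_mono) auto
  finally have "norm (1 + s) \<le> norm s"
    using pos by (simp add: power_mono_iff)
  then have "(norm (1 + s))\<^sup>2 \<le> (norm s)\<^sup>2"
    by (intro power_mono) auto
  then have "(1 + Re s)\<^sup>2 \<le> (Re s)\<^sup>2"
    by (simp add: cmod_power2)
  then show ?thesis
    by (simp add: power2_eq_square algebra_simps)
qed

end

lemma exists_root_of_unity_Re_nonpos:
  assumes "2 \<le> n"
  obtains \<omega> :: complex where "\<omega> ^ n = 1" "Re \<omega> \<le> 0"
proof -
  \<comment> \<open>Among the \<open>n\<close>-th roots of unity, the one of index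
    \<open>n div 2\<close> has its angle between \<open>pi / 2\<close> and \<open>pi\<close> once
    \<open>n\<close> is at least \<open>2\<close>.\<close>
  define \<omega> where "\<omega> = cis (2 * pi * real (n div 2) / real n)"
  have "\<omega> ^ n = cis (2 * pi * real (n div 2))"
    using assms by (simp add: \<omega>_def Complex.DeMoivre)
  also have "\<dots> = 1"
    by (metis cis_multiple_2pi Ints_of_nat)
  finally have "\<omega> ^ n = 1" .
  moreover have "Re \<omega> \<le> 0"
  proof -
    have "n \<le> 4 * (n div 2)" "2 * (n div 2) \<le> n"
      using assms by linarith+
    then have "real n \<le> 4 * real (n div 2)" "2 * real (n div 2) \<le> real n"
      by linarith+
    then have "pi / 2 \<le> 2 * pi * real (n div 2) / real n" "2 * pi * real (n div 2) / real n \<le> pi"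
      using assms by (simp_all add: field_simps)
    then have "cos (2 * pi * real (n div 2) / real n) \<le> cos (pi / 2)"
      by (intro cos_monotone_0_pi_le) auto
    then show ?thesis by (simp add: \<omega>_def)
  qed
  ultimately show thesis by (rule that)
qed

text \<open>With \<open>t = 1 - Re w\<close>, which is at least \<open>1\<close>, the real part is
  \<open>- t / (t ^ 2 + (Im w) ^ 2)\<close>, and the denominator is at least
  \<open>t\<close>.\<close>

lemma Re_neg_inverse_ge:
  fixes w :: complex
  assumes "Re w \<le> 0"
  shows "- 1 \<le> Re (- 1 / (1 - w))"
proof -
  have "1 - Re w \<le> (1 - Re w)\<^sup>2 + (Im w)\<^sup>2"
    using assms mult_mono[of 1 "1 - Re w" "1 - Re w" "1 - Re w"]
    by (simp add: power2_eq_square add_increasing2)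
  moreover have "0 < (1 - Re w)\<^sup>2 + (Im w)\<^sup>2"
    using calculation assms by linarith
  ultimately show ?thesis
    by (simp add: Re_divide divide_le_eq)
qed

section \<open>From tangential bodies to the inequalities for the real parts\<close>

text \<open>The hyperplane through \<open>x\<close> with normal \<open>u\<close> supports
  \<open>K\<close> but misses \<open>E\<close>, so \<open>x\<close> is \<open>0\<close>-singular,
  which means that its normal cone is full.\<close>

lemma cap_body_tangential_body:
  fixes K E :: "'a::euclidean_space set"
  assumes tang: "tangential_body 1 K E" and int: "interior E \<noteq> {}"
  shows "cap_body K E"
proof
  show "compact K" "convex K" "compact E" "convex E" "E \<subseteq> K"
    using tang by (auto simp: tangential_body_def convex_body_def)
  show "interior E \<noteq> {}" by fact
next
  fix x u assume x: "x \<in> K" "u \<in> normal_cone K x" "\<forall>e\<in>E. u \<bullet> e < u \<bullet> x"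
  define H where "H = {y. u \<bullet> y = u \<bullet> x}"
  have "E \<noteq> {}" using int interior_subset by blast
  then have "u \<noteq> 0" using x(3) by auto
  then have "support_hyperplane K H"
    using x unfolding support_hyperplane_def H_def normal_cone_def inner_diff_right
    by (intro exI[of _ u] exI[of _ "u \<bullet> x"]) auto
  moreover have "E \<inter> H = {}"
    using x(3) by (auto simp: H_def)
  then have "\<not> support_hyperplane E H"
    by (auto simp: support_hyperplane_def)
  ultimately have "singular_point 0 K x"
    using tang x(1) by (auto simp: tangential_body_def H_def)
  then have "DIM('a) \<le> dim (normal_cone K x)"
    by (simp add: singular_point_def)
  then show "dim (normal_cone K x) = DIM('a)"
    using dim_subset_UNIV[of "normal_cone K x"] by simp
qed

lemma sorted_list_of_multiset_bounds:
  assumes "x \<in># M"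
  shows "sorted_list_of_multiset M ! 0 \<le> x"
    and "x \<le> sorted_list_of_multiset M ! (size M - 1)"
proof -
  define xs where "xs = sorted_list_of_multiset M"
  have "sorted xs" "length xs = size M" "x \<in> set xs"
    using assms by (simp_all add: xs_def)
      (metis mset_sorted_list_of_multiset size_mset)
  then obtain i where "i < length xs" "xs ! i = x"
    by (auto simp: in_set_conv_nth)
  with \<open>sorted xs\<close> have "xs ! 0 \<le> x" "x \<le> xs ! (length xs - 1)"
    by (auto intro!: sorted_nth_mono)
  then show "sorted_list_of_multiset M ! 0 \<le> x" "x \<le> sorted_list_of_multiset M ! (size M - 1)"
    using \<open>length xs = size M\<close> by (simp_all add: xs_def)
qed

theorem theorem1p1:
  fixes K E :: "(real ^ 'n) set" and a :: "real list"
  assumes "convex_body K" and "interior K \<noteq> {}"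
    and "convex_body E" and "interior E \<noteq> {}"
    and "tangential_body 1 K E"
    and "a = sorted_list_of_multiset (image_mset Re (proots (steiner_poly K E)))"
  shows "length a = CARD('n) \<and>
    a ! 0 \<le> - relative_circumradius K E \<and>
    - relative_circumradius K E \<le> - relative_inradius K E \<and>
    - relative_inradius K E \<le> a ! (CARD('n) - 1) \<and>
    a ! (CARD('n) - 1) \<le> 0"
proof -
  interpret cap_body K E
    using cap_body_tangential_body assms by blast
  let ?n = "CARD('n)"
  define M where "M = image_mset Re (proots (steiner_poly K E))"
  have n: "DIM(real ^ 'n) = ?n" by simp
  \<comment> \<open>Part of \<open>tangential_body 1\<close>; both the value of the inradius and the
    choice of \<open>\<omega>\<close> below rely on it.\<close>
  have "2 \<le> ?n"
    using assms(5) by (simp add: tangential_body_def)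
  have "steiner_poly K E \<noteq> 0"
    using degree_steiner_poly by auto
  then have M: "r \<in># M \<longleftrightarrow> (\<exists>s. poly (steiner_poly K E) s = 0 \<and> r = Re s)" for r
    by (auto simp: M_def)
  have size_M: "size M = ?n"
    using degree_steiner_poly by (simp add: M_def size_proots_complex)
  have a: "a = sorted_list_of_multiset M"
    using assms(6) by (simp add: M_def)
  then have length_a: "length a = ?n"
    using size_M by (metis mset_sorted_list_of_multiset size_mset)
  define \<beta> where "\<beta> = root ?n (1 - measure lebesgue E / measure lebesgue K)"
  have "0 < measure lebesgue K"
    using measure_E_pos measure_E_le_K by linarith
  then have \<beta>: "0 \<le> \<beta>" "\<beta> < 1"
    and vol: "\<beta> ^ ?n * measure lebesgue K = measure lebesgue K - measure lebesgue E"
    using measure_E_pos measure_E_le_K by (auto simp: \<beta>_def field_simps)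
  have root: "Re (- 1 / (1 - of_real \<beta> * \<omega>)) \<in># M" if "\<omega> ^ ?n = 1" for \<omega>
    using steiner_root[OF \<beta>] vol that M unfolding n by blast
  \<comment> \<open>The root of unity \<open>1\<close> yields the real root
    \<open>- 1 / (1 - \<beta>)\<close>, the one that bounds the circumradius.\<close>
  have "a ! 0 \<le> Re (- 1 / (1 - of_real \<beta> * 1))"
    unfolding a by (rule sorted_list_of_multiset_bounds[OF root]) simp
  also have "\<dots> = - (1 / (1 - \<beta>))"
    by (metis Re_complex_of_real minus_divide_left mult.right_neutral of_real_1 of_real_diff
        of_real_divide of_real_minus)
  also have "\<dots> \<le> - relative_circumradius K E"
    using relative_circumradius_le[OF \<beta>] vol by simp
  finally have low: "a ! 0 \<le> - relative_circumradius K E" .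
  obtain \<omega> :: complex where \<omega>: "\<omega> ^ ?n = 1" "Re \<omega> \<le> 0"
    using exists_root_of_unity_Re_nonpos[OF \<open>2 \<le> ?n\<close>] .
  \<comment> \<open>As the inradius is \<open>1\<close>, a single root with real part at least
    \<open>- 1\<close> settles the bound on the largest real part.\<close>
  have "- 1 \<le> Re (- 1 / (1 - of_real \<beta> * \<omega>))"
    using \<beta> \<omega> by (intro Re_neg_inverse_ge) (simp add: mult_nonneg_nonpos)
  also have "\<dots> \<le> a ! (?n - 1)"
    unfolding a size_M[symmetric] by (rule sorted_list_of_multiset_bounds[OF root[OF \<omega>(1)]])
  finally have high: "- 1 \<le> a ! (?n - 1)" .
  have "a ! (?n - 1) \<in> set a"
    using length_a by simp
  then have "a ! (?n - 1) \<le> 0"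
    using M Re_steiner_root_nonpos unfolding a by auto
  moreover have "relative_inradius K E = 1"
    using relative_inradius_eq_1 \<open>2 \<le> ?n\<close> by simp
  ultimately show ?thesis
    using length_a low high relative_circumradius_ge_1 by simp
qed

end
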